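(* Let $\mathcal H$ be a real Hilbert space, $C\subseteq\mathcal H$ nonempty, closed and convex, and $F:\mathcal H\to\mathcal H$. Assume that $SOL(C,F)\neq\emptyset$, that $F$ is monotone on $\mathcal H$ ($\langle F(x)-F(y),x-y\rangle\ge 0$ for all $x,y\in\mathcal H$), and that $F$ is Lipschitz continuous on $\mathcal H$ with some constant $L>0$. Let the perturbation vectors satisfy $\sum_{k=0}^\infty\|e_i^k\|<+\infty$ for $i=1,2$, and $\|e_1^k\|\le\mu\|x^k-y^k\|$ for all $k\ge0$, where $\mu\in[0,1-\nu)$. Then any sequence $\{x^k\}_{k=0}^\infty$ generated by the PC-algorithm II with outer perturbations (described in the context) converges weakly to a point of $SOL(C,F)$, i.e. to a solution of the variational inequality problem.
   Context: The variational inequality problem is: find $x^*\in C$ with $\langle F(x^* ),x-x^*\rangle\ge 0$ for all $x\in C$; its solution set is $SOL(C,F)$. $P_C$ denotes the metric projection onto $C$. PC-algorithm II with outer perturbations: fix $\nu\in(0,1)$ and $\gamma\in(0,2)$. Choose $x^0\in\mathcal H$ arbitrarily. Given $x^k\in\mathcal H$ and perturbation vectors $e_1^k=e_1(x^k)$, $e_2^k=e_2(x^k)$ in $\mathcal H$, set $$y^k=P_C(x^k-\beta_kF(x^k)+e_1^k),$$ where $\beta_k>0$ is selected such that $\beta_k\|F(x^k)-F(y^k)\|\le\nu\|x^k-y^k\|$. Define $$d(x^k,y^k)=(x^k-y^k)-\beta_k(F(x^k)-F(y^k))+e_1^k,\qquad \rho_k=\frac{\langle x^k-y^k,d(x^k,y^k)\rangle}{\|d(x^k,y^k)\|^2},$$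 $$x^{k+1}=P_C(x^k-\gamma\rho_k\beta_kF(y^k)+e_2^k).$$ It is understood that $d(x^k,y^k)\ne0$ for all $k$, so that $\rho_k$ is defined.
   Formalization: The step sizes β_k are additionally assumed bounded below by a positive constant; without this the claim fails (H = C = R, F(t) = t, no perturbations, ν = 1/2, γ = 1, x^k = 1 + 2^{-k} tends to 1, not to the solution 0). *)

theory Defs
  imports "HOL-Analysis.Analysis"
begin

definition VI_SOL :: "'a::real_inner set \<Rightarrow> ('a \<Rightarrow> 'a) \<Rightarrow> 'a set"
  where "VI_SOL C F = {z \<in> C. \<forall>x\<in>C. 0 \<le> inner (F z) (x - z)}"

(* closest_point of HOL-Analysis is restricted to Heine-Borel, hence finite-dimensional, types.
   On a nonempty closed convex subset of a Hilbert space the nearest point exists and is unique;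
   otherwise the value may be arbitrary. *)
definition metric_proj :: "'a::metric_space set \<Rightarrow> 'a \<Rightarrow> 'a"
  where "metric_proj C u = (THE p. p \<in> C \<and> (\<forall>q\<in>C. dist u p \<le> dist u q))"

definition monotone_operator :: "('a::real_inner \<Rightarrow> 'a) \<Rightarrow> bool"
  where "monotone_operator F \<longleftrightarrow> (\<forall>x y. 0 \<le> inner (F x - F y) (x - y))"

definition weakly_converges :: "(nat \<Rightarrow> 'a::real_normed_vector) \<Rightarrow> 'a \<Rightarrow> bool"
  where "weakly_converges x l \<longleftrightarrow>
    (\<forall>f :: 'a \<Rightarrow> real. bounded_linear f \<longrightarrow> (\<lambda>k. f (x k)) \<longlonglongrightarrow> f l)"

(* u, v, b, e stand for x^k, y^k, beta_k, e_1^k. *)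
definition PC_d :: "('a::real_inner \<Rightarrow> 'a) \<Rightarrow> real \<Rightarrow> 'a \<Rightarrow> 'a \<Rightarrow> 'a \<Rightarrow> 'a"
  where "PC_d F b e u v = (u - v) - b *\<^sub>R (F u - F v) + e"

definition PC_rho :: "('a::real_inner \<Rightarrow> 'a) \<Rightarrow> real \<Rightarrow> 'a \<Rightarrow> 'a \<Rightarrow> 'a \<Rightarrow> real"
  where "PC_rho F b e u v = inner (u - v) (PC_d F b e u v) / (norm (PC_d F b e u v))\<^sup>2"

(* The projection-contraction method as a relation: y, beta are auxiliary outputs of a run x.
   The perturbations e_i(x^k) may differ from step to step, so they are arbitrary sequences.
   The selection rule alone admits step sizes tending to 0, for which weak convergence to a
   solution can fail (F = id on C = R, no perturbations, summable beta); a positive lower bound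
   on beta is a separate hypothesis. *)
definition PC_II_run ::
  "'a::real_inner set \<Rightarrow> ('a \<Rightarrow> 'a) \<Rightarrow> real \<Rightarrow> real \<Rightarrow> (nat \<Rightarrow> 'a) \<Rightarrow> (nat \<Rightarrow> 'a) \<Rightarrow>
   (nat \<Rightarrow> real) \<Rightarrow> (nat \<Rightarrow> 'a) \<Rightarrow> (nat \<Rightarrow> 'a) \<Rightarrow> bool"
  where "PC_II_run C F \<nu> \<gamma> e1 e2 \<beta> x y \<longleftrightarrow>
    (\<forall>k. y k = metric_proj C (x k - \<beta> k *\<^sub>R F (x k) + e1 k) \<and>
         0 < \<beta> k \<and>
         \<beta> k * norm (F (x k) - F (y k)) \<le> \<nu> * norm (x k - y k) \<and>
         PC_d F (\<beta> k) (e1 k) (x k) (y k) \<noteq> 0 \<and>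
         x (Suc k) = metric_proj C
           (x k - (\<gamma> * PC_rho F (\<beta> k) (e1 k) (x k) (y k) * \<beta> k) *\<^sub>R F (y k) + e2 k))"

end

theory Submission
  imports Defs
begin

text \<open>
  Write \<open>d\<^sub>k\<close> and \<open>\<rho>\<^sub>k\<close> for the direction and the step ratio of the method. The projection that
  defines \<open>y k\<close> shows that \<open>d\<^sub>k\<close> may replace \<open>\<beta> k *\<^sub>R F (y k)\<close> when it is paired with
  \<open>y k - x (Suc k)\<close>, and \<open>\<rho>\<^sub>k\<close> is the minimiser of the resulting quadratic
  \<open>\<rho>\<^sup>2 * (norm d\<^sub>k)\<^sup>2 - 2 * \<rho> * inner (x k - y k) d\<^sub>k\<close>. Relaxation by a factor \<open>\<gamma>\<close> between 0 and 2
  still decreases the squared distance to every solution, by a fixed multiple of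
  \<open>(norm (x k - y k))\<^sup>2\<close>, up to an error of order \<open>norm (e2 k)\<close> (\<open>PC_step_descent\<close>,
  \<open>PC_progress\<close>). As the errors are summable, the distance to each solution converges, and then
  \<open>x k - y k\<close> tends to 0.

  Monotonicity and the projection defining \<open>y k\<close> next give, for every \<open>u\<close> in \<open>C\<close>, a lower bound for
  \<open>inner (F u) (u - x k)\<close> that tends to 0 (\<open>PC_residual_ge\<close>). This is where a positive lower bound of
  the step sizes enters. Any weak cluster point \<open>w\<close> of \<open>x\<close> therefore satisfies
  \<open>0 \<le> inner (F u) (u - w)\<close> for all \<open>u\<close> in \<open>C\<close>, which by \<open>minty\<close> makes it a solution. Opial's
  argument (\<open>opial_tail_hull\<close>) then yields weak convergence of the whole sequence.

  Weak sequential compactness of bounded sets is replaced by a more elementary fact: a decreasing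
  sequence of nonempty bounded closed convex sets has a common point
  (\<open>nested_closed_convex_nonempty_Inter\<close>). It is applied to the closed convex hulls of the tails
  of \<open>x\<close>. Their common points serve as weak cluster points, since an affine inequality valid
  along the tail passes to them. The same fact gives the existence of metric projections.
\<close>


section \<open>Nested convex sets and the metric projection\<close>

text \<open>Cut each \<open>K n\<close> with a ball about 0 that is slightly larger than the limit \<open>r\<close> of the distances
  from 0 to the sets. The midpoint of two points of the cut lies in \<open>K n\<close> and so cannot be much closer
  to 0 than \<open>r\<close>. The parallelogram identity then makes the diameters of the cuts shrink to 0, and
  completeness applies.\<close>

lemma nested_closed_convex_nonempty_Inter:
  fixes K :: "nat \<Rightarrow> 'a::{real_inner, complete_space} set"
  assumes ne: "\<And>n. K n \<noteq> {}" and cl: "\<And>n. closed (K n)" and cv: "\<And>n. convex (K n)"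
    and dec: "\<And>m n. m \<le> n \<Longrightarrow> K n \<subseteq> K m" and bd: "bounded (K 0)"
  obtains w where "\<And>n. w \<in> K n"
proof -
  obtain B where B: "\<And>v. v \<in> K 0 \<Longrightarrow> norm v \<le> B"
    using bd unfolding bounded_iff by blast
  define d where "d n = infdist 0 (K n)" for n
  have "incseq d"
    unfolding incseq_def d_def using infdist_mono[OF dec ne] by blast
  moreover have "\<forall>n. d n \<le> B"
  proof
    fix n
    obtain v where "v \<in> K n" using ne by blast
    then show "d n \<le> B"
      using dec[of 0 n] B[of v] infdist_le[of v "K n" 0] by (auto simp: d_def)
  qed
  ultimately obtain r where r: "d \<longlonglongrightarrow> r" "\<forall>n. d n \<le> r"
    using incseq_convergent by blast
  define s where "s n = r + inverse (real (Suc n))" for n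
  have s: "s \<longlonglongrightarrow> r"
    unfolding s_def by (rule LIMSEQ_inverse_real_of_nat_add)
  define S where "S n = K n \<inter> cball 0 (s n)" for n
  have d_lower: "d n \<le> norm v" if "v \<in> K n" for n v
    using infdist_le[OF that, of 0] by (simp add: d_def)
  have width: "(dist a b)\<^sup>2 \<le> 4 * ((s n)\<^sup>2 - (d n)\<^sup>2)" if "a \<in> S n" "b \<in> S n" for a b n
  proof -
    have "(1/2) *\<^sub>R a + (1/2) *\<^sub>R b \<in> K n"
      using that convexD[OF cv, of a n b "1/2" "1/2"] by (auto simp: S_def)
    then have "d n \<le> norm ((1/2) *\<^sub>R (a + b))"
      unfolding scaleR_add_right by (rule d_lower)
    then have "2 * d n \<le> norm (a + b)" by simp
    then have "(2 * d n)\<^sup>2 \<le> (norm (a + b))\<^sup>2"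
      by (intro power_mono) (auto simp: d_def infdist_nonneg)
    moreover have "(norm a)\<^sup>2 \<le> (s n)\<^sup>2" "(norm b)\<^sup>2 \<le> (s n)\<^sup>2"
      using that by (auto simp: S_def intro: power_mono)
    moreover have "(dist a b)\<^sup>2 + (norm (a + b))\<^sup>2 = 2 * (norm a)\<^sup>2 + 2 * (norm b)\<^sup>2"
      by (simp add: dist_norm power2_norm_eq_inner inner_diff inner_add inner_commute)
    ultimately show ?thesis by (simp add: power_mult_distrib)
  qed
  obtain w where w: "\<And>n. w \<in> S n"
  proof (rule decreasing_closed_nest[of S])
    show "closed (S n)" for n
      using cl by (auto simp: S_def)
    show "S n \<noteq> {}" for n
    proof
      assume empty: "S n = {}"
      have "s n \<le> d n"
        unfolding d_def infdist_notempty[OF ne]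
      proof (rule cINF_greatest[OF ne])
        fix v assume "v \<in> K n"
        then show "s n \<le> dist 0 v" using empty by (auto simp: S_def)
      qed
      moreover have "d n \<le> r" "0 < inverse (real (Suc n))" using r(2) by auto
      ultimately show False unfolding s_def by linarith
    qed
    show "S n \<subseteq> S m" if "m \<le> n" for m n
    proof -
      have "s n \<le> s m" using that by (simp add: s_def field_simps)
      then show ?thesis using dec[OF that] by (auto simp: S_def)
    qed
    show "\<exists>n. \<forall>a\<in>S n. \<forall>b\<in>S n. dist a b < \<epsilon>" if "0 < \<epsilon>" for \<epsilon>
    proof -
      have "(\<lambda>n. 4 * ((s n)\<^sup>2 - (d n)\<^sup>2)) \<longlonglongrightarrow> 4 * (r\<^sup>2 - r\<^sup>2)"
        by (intro tendsto_intros s r(1))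
      then have "eventually (\<lambda>n. 4 * ((s n)\<^sup>2 - (d n)\<^sup>2) < \<epsilon>\<^sup>2) sequentially"
        using that by (intro order_tendstoD(2)) auto
      then obtain n where n: "4 * ((s n)\<^sup>2 - (d n)\<^sup>2) < \<epsilon>\<^sup>2"
        by (auto simp: eventually_sequentially)
      have "dist a b < \<epsilon>" if "a \<in> S n" "b \<in> S n" for a b
        using order_le_less_trans[OF width[OF that] n] \<open>0 < \<epsilon>\<close>
        by (rule power2_less_imp_less[OF _ less_imp_le])
      then show ?thesis by blast
    qed
  qed (rule that, blast)
  then show thesis using that by (auto simp: S_def)
qed

text \<open>The sets of points of \<open>C\<close> whose distance to \<open>u\<close> exceeds the infimum by at most
  \<open>1 / (n + 1)\<close> are nested. A common point attains the infimum.\<close>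

lemma nearest_point_exists:
  fixes C :: "'a::{real_inner, complete_space} set"
  assumes "C \<noteq> {}" "closed C" "convex C"
  shows "\<exists>p\<in>C. \<forall>q\<in>C. dist u p \<le> dist u q"
proof -
  define K where "K n = C \<inter> cball u (infdist u C + inverse (real (Suc n)))" for n
  obtain p where p: "\<And>n. p \<in> K n"
  proof (rule nested_closed_convex_nonempty_Inter[of K])
    show "closed (K n)" "convex (K n)" for n
      using assms by (auto simp: K_def intro: convex_Int)
    show "bounded (K 0)"
      by (simp add: K_def bounded_Int)
    show "K n \<subseteq> K m" if "m \<le> n" for m n
    proof -
      have "inverse (real (Suc n)) \<le> inverse (real (Suc m))"
        using that by (simp add: field_simps)
      then show ?thesis
        unfolding K_def by (intro Int_mono order_refl subset_cball add_left_mono)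
    qed
    show "K n \<noteq> {}" for n
    proof
      assume empty: "K n = {}"
      have "infdist u C + inverse (real (Suc n)) \<le> (INF v\<in>C. dist u v)"
      proof (rule cINF_greatest[OF assms(1)])
        fix v assume "v \<in> C"
        then show "infdist u C + inverse (real (Suc n)) \<le> dist u v"
          using empty by (auto simp: K_def)
      qed
      moreover have "0 < inverse (real (Suc n))" by simp
      ultimately show False unfolding infdist_notempty[OF assms(1)] by linarith
    qed
  qed (rule that, blast)
  have "dist u p \<le> infdist u C"
  proof (rule LIMSEQ_le_const[OF LIMSEQ_inverse_real_of_nat_add])
    show "\<exists>N. \<forall>n\<ge>N. dist u p \<le> infdist u C + inverse (real (Suc n))"
      using p by (auto simp: K_def)
  qed
  then have "\<forall>q\<in>C. dist u p \<le> dist u q"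
    using infdist_le[of _ C u] by force
  moreover have "p \<in> C" using p[of 0] by (simp add: K_def)
  ultimately show ?thesis by blast
qed

lemma metric_proj_nearest:
  fixes C :: "'a::{real_inner, complete_space} set"
  assumes "C \<noteq> {}" "closed C" "convex C"
  shows "metric_proj C u \<in> C \<and> (\<forall>q\<in>C. dist u (metric_proj C u) \<le> dist u q)"
proof -
  obtain p where p: "p \<in> C" "\<forall>q\<in>C. dist u p \<le> dist u q"
    using nearest_point_exists[OF assms, of u] by blast
  have "\<exists>!p. p \<in> C \<and> (\<forall>q\<in>C. dist u p \<le> dist u q)"
  proof (rule ex1I)
    show "p \<in> C \<and> (\<forall>q\<in>C. dist u p \<le> dist u q)" using p by simp
    show "p' = p" if "p' \<in> C \<and> (\<forall>q\<in>C. dist u p' \<le> dist u q)" for p'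
      by (rule any_closest_point_unique[OF assms(3,2), of _ _ u]) (use p that in simp_all)
  qed
  then show ?thesis unfolding metric_proj_def by (rule theI')
qed

lemma metric_proj_mem:
  fixes C :: "'a::{real_inner, complete_space} set"
  assumes "C \<noteq> {}" "closed C" "convex C"
  shows "metric_proj C u \<in> C"
  using metric_proj_nearest[OF assms, of u] by simp

lemma metric_proj_obtuse_angle:
  fixes C :: "'a::{real_inner, complete_space} set"
  assumes "C \<noteq> {}" "closed C" "convex C" "q \<in> C"
  shows "inner (u - metric_proj C u) (q - metric_proj C u) \<le> 0"
  by (rule any_closest_point_dot[OF assms(3,2) _ assms(4)])
     (use metric_proj_nearest[OF assms(1-3), of u] in simp_all)


section \<open>Tail hulls and Opial's argument\<close>

text \<open>By Mazur's theorem every weak cluster point of \<open>x\<close> lies in all tail hulls. The converse fails in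
  general, but common points exist for bounded sequences and inherit eventual linear inequalities, and these are
  the two properties of weak cluster points that Opial's argument needs.\<close>

definition tail_hull :: "(nat \<Rightarrow> 'a::real_normed_vector) \<Rightarrow> nat \<Rightarrow> 'a set"
  where "tail_hull x n = closure (convex hull (x ` {n..}))"

lemma tail_hull_subset:
  assumes "closed S" "convex S" "\<And>k. n \<le> k \<Longrightarrow> x k \<in> S"
  shows "tail_hull x n \<subseteq> S"
  unfolding tail_hull_def using assms by (intro closure_minimal hull_minimal) auto

lemma tail_hull_subsequence:
  assumes "strict_mono r"
  shows "tail_hull (x \<circ> r) n \<subseteq> tail_hull x n"
proof -
  have "(x \<circ> r) ` {n..} \<subseteq> x ` {n..}"
    using seq_suble[OF assms] by (force intro: order_trans)
  then show ?thesis
    unfolding tail_hull_def by (intro closure_mono hull_mono)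
qed

lemma tail_hulls_common_point:
  fixes x :: "nat \<Rightarrow> 'a::{real_inner, complete_space}"
  assumes "bounded (range x)"
  obtains w where "\<And>n. w \<in> tail_hull x n"
proof (rule nested_closed_convex_nonempty_Inter[of "tail_hull x"])
  show "tail_hull x n \<noteq> {}" "closed (tail_hull x n)" "convex (tail_hull x n)" for n
    by (auto simp: tail_hull_def)
  show "tail_hull x n \<subseteq> tail_hull x m" if "m \<le> n" for m n
    unfolding tail_hull_def using that by (intro closure_mono hull_mono) auto
  have "bounded (x ` {0..})"
    using assms by (rule bounded_subset) auto
  then show "bounded (tail_hull x 0)"
    unfolding tail_hull_def by (intro bounded_closure bounded_convex_hull)
qed (rule that, blast)

lemma tail_hull_linear_ge:
  fixes f :: "'a::real_normed_vector \<Rightarrow> real"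
  assumes f: "bounded_linear f" and ev: "eventually (\<lambda>k. b \<le> f (x k)) sequentially"
    and w: "\<And>n. w \<in> tail_hull x n"
  shows "b \<le> f w"
proof -
  obtain N where N: "\<And>k. N \<le> k \<Longrightarrow> b \<le> f (x k)"
    using ev by (auto simp: eventually_sequentially)
  have "closed {v. b \<le> f v}"
    using f by (intro closed_Collect_le continuous_intros linear_continuous_on)
  moreover have "convex {v. b \<le> f v}"
    using convex_linear_vimage[OF bounded_linear.linear[OF f], of "{b..}"]
    by (simp add: vimage_def)
  ultimately have "tail_hull x N \<subseteq> {v. b \<le> f v}"
    using N by (intro tail_hull_subset) auto
  then show ?thesis using w by blast
qed

lemma tail_hull_linear_limit:
  fixes f :: "'a::real_normed_vector \<Rightarrow> real"
  assumes f: "bounded_linear f" and lim: "(\<lambda>k. f (x k)) \<longlonglongrightarrow> l"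
    and w: "\<And>n. w \<in> tail_hull x n"
  shows "f w = l"
proof (rule antisym)
  show "l \<le> f w"
  proof (rule dense_le)
    fix b assume "b < l"
    then have "eventually (\<lambda>k. b \<le> f (x k)) sequentially"
      by (rule eventually_mono[OF order_tendstoD(1)[OF lim]]) simp
    then show "b \<le> f w" using tail_hull_linear_ge[OF f _ w] by blast
  qed
  show "f w \<le> l"
  proof (rule dense_ge)
    fix b assume "l < b"
    then have "eventually (\<lambda>k. - b \<le> - f (x k)) sequentially"
      by (rule eventually_mono[OF order_tendstoD(2)[OF lim]]) simp
    then have "- b \<le> - f w"
      using tail_hull_linear_ge[OF bounded_linear_minus[OF f] _ w] by blast
    then show "f w \<le> b" by simp
  qed
qed

text \<open>If \<open>f (x k)\<close> stayed away from \<open>f w\<close> along a subsequence, the tail hulls of that subsequence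
  would have a common point separated from \<open>w\<close> by \<open>f\<close>. It would also be common to the tail hulls of
  \<open>x\<close>, against uniqueness.\<close>

lemma weakly_converges_if_unique_tail_hull_point:
  fixes x :: "nat \<Rightarrow> 'a::{real_inner, complete_space}"
  assumes bd: "bounded (range x)" and uniq: "\<And>v. (\<And>n. v \<in> tail_hull x n) \<Longrightarrow> v = w"
  shows "weakly_converges x w"
  unfolding weakly_converges_def
proof (intro allI impI)
  fix f :: "'a \<Rightarrow> real" assume f: "bounded_linear f"
  have below: "eventually (\<lambda>k. g (x k) < b) sequentially"
    if g: "bounded_linear g" and b: "g w < b" for g :: "'a \<Rightarrow> real" and b
  proof (rule ccontr)
    assume "\<not> ?thesis"
    then have "infinite {k. b \<le> g (x k)}"
      by (simp add: not_eventually frequently_cofinite[symmetric] cofinite_eq_sequentially not_less)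
    then obtain r :: "nat \<Rightarrow> nat" where r: "strict_mono r" "\<And>j. b \<le> g (x (r j))"
      using infinite_enumerate[of "{k. b \<le> g (x k)}"] by auto
    obtain v where v: "\<And>n. v \<in> tail_hull (x \<circ> r) n"
    proof (rule tail_hulls_common_point[of "x \<circ> r"])
      show "bounded (range (x \<circ> r))" by (rule bounded_subset[OF bd]) auto
    qed (rule that, blast)
    then have "v = w"
      using tail_hull_subsequence[OF r(1), of x] by (intro uniq) blast
    moreover have "b \<le> g v"
      using r(2) by (intro tail_hull_linear_ge[OF g _ v]) simp
    ultimately show False using b by simp
  qed
  show "(\<lambda>k. f (x k)) \<longlonglongrightarrow> f w"
  proof (rule order_tendstoI)
    fix b assume "f w < b"
    then show "eventually (\<lambda>k. f (x k) < b) sequentially" by (rule below[OF f])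
  next
    fix b assume "b < f w"
    then show "eventually (\<lambda>k. b < f (x k)) sequentially"
      using below[OF bounded_linear_minus[OF f], of "- b"] by simp
  qed
qed

text \<open>For \<open>v\<close> and \<open>w\<close> in \<open>S\<close> the difference of the squared distances from \<open>x k\<close> is affine in \<open>x k\<close>
  with gradient a multiple of \<open>w - v\<close>. Its convergence fixes the value of \<open>inner (w - v)\<close> at every
  common point of the tail hulls. Taking \<open>v\<close> and \<open>w\<close> themselves to be common points gives \<open>v = w\<close>.\<close>

lemma opial_tail_hull:
  fixes x :: "nat \<Rightarrow> 'a::{real_inner, complete_space}"
  assumes "S \<noteq> {}"
    and conv: "\<And>z. z \<in> S \<Longrightarrow> convergent (\<lambda>k. norm (x k - z))"
    and sub: "\<And>w. (\<And>n. w \<in> tail_hull x n) \<Longrightarrow> w \<in> S"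
  shows "\<exists>z\<in>S. weakly_converges x z"
proof -
  obtain z where "z \<in> S" using \<open>S \<noteq> {}\<close> by blast
  then obtain B where B: "\<And>k. norm (x k - z) \<le> B"
    using convergent_imp_Bseq[OF conv] by (auto simp: Bseq_def)
  have "norm (x k) \<le> B + norm z" for k
    using B[of k] norm_triangle_sub[of "x k" z] by linarith
  then have bd: "bounded (range x)" by (auto simp: bounded_iff)
  obtain w where w: "\<And>n. w \<in> tail_hull x n"
    by (rule tail_hulls_common_point[OF bd]) (rule that, blast)
  have "v = w" if v: "\<And>n. v \<in> tail_hull x n" for v
  proof -
    have "v \<in> S" "w \<in> S" by (rule sub, fact v) (rule sub, fact w)
    then obtain lv lw where
      "(\<lambda>k. norm (x k - v)) \<longlonglongrightarrow> lv" "(\<lambda>k. norm (x k - w)) \<longlonglongrightarrow> lw"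
      using conv by (meson convergent_def)
    then have "(\<lambda>k. ((norm (x k - v))\<^sup>2 - (norm (x k - w))\<^sup>2 + (norm w)\<^sup>2 - (norm v)\<^sup>2) / 2)
        \<longlonglongrightarrow> (lv\<^sup>2 - lw\<^sup>2 + (norm w)\<^sup>2 - (norm v)\<^sup>2) / 2" (is "_ \<longlonglongrightarrow> ?l")
      by (intro tendsto_intros) auto
    moreover have "((norm (x k - v))\<^sup>2 - (norm (x k - w))\<^sup>2 + (norm w)\<^sup>2 - (norm v)\<^sup>2) / 2
        = inner (w - v) (x k)" for k
      by (simp add: power2_norm_eq_inner inner_diff inner_commute)
    ultimately have lim: "(\<lambda>k. inner (w - v) (x k)) \<longlonglongrightarrow> ?l" by simp
    have "inner (w - v) w = ?l" "inner (w - v) v = ?l"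
      by (rule tail_hull_linear_limit[OF bounded_linear_inner_right lim], fact w)
         (rule tail_hull_linear_limit[OF bounded_linear_inner_right lim], fact v)
    then have "inner (w - v) (w - v) = 0" by (simp add: inner_diff_right)
    then show "v = w" by simp
  qed
  then have "weakly_converges x w"
    by (rule weakly_converges_if_unique_tail_hull_point[OF bd])
  moreover have "w \<in> S" by (rule sub) (fact w)
  ultimately show ?thesis by blast
qed


section \<open>Variational inequalities\<close>

text \<open>The test points \<open>w + t *\<^sub>R (v - w)\<close> approach \<open>w\<close> along the segment to \<open>v\<close>. After division by
  \<open>t\<close>, continuity moves \<open>F\<close> from the test point to \<open>w\<close>. The hypothesis is affine in \<open>w\<close>, which is why
  it can be checked for weak limits while the conclusion cannot.\<close>

lemma minty:
  fixes F :: "'a::real_inner \<Rightarrow> 'a"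
  assumes "convex C" "w \<in> C" and cont: "continuous_on UNIV F"
    and weak: "\<And>u. u \<in> C \<Longrightarrow> 0 \<le> inner (F u) (u - w)"
  shows "w \<in> VI_SOL C F"
proof -
  have "0 \<le> inner (F w) (v - w)" if "v \<in> C" for v
  proof -
    define t where "t n = inverse (real (Suc n))" for n
    have "0 \<le> inner (F (w + t n *\<^sub>R (v - w))) (v - w)" for n
    proof -
      have t: "0 < t n" "t n \<le> 1" by (auto simp: t_def inverse_le_1_iff)
      have "w + t n *\<^sub>R (v - w) = (1 - t n) *\<^sub>R w + t n *\<^sub>R v"
        by (simp add: algebra_simps)
      also have "\<dots> \<in> C"
        using convexD_alt[OF \<open>convex C\<close> \<open>w \<in> C\<close> that] t by auto
      finally have "0 \<le> t n * inner (F (w + t n *\<^sub>R (v - w))) (v - w)"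
        using weak by force
      then show ?thesis using t by (simp add: zero_le_mult_iff)
    qed
    moreover have "(\<lambda>n. inner (F (w + t n *\<^sub>R (v - w))) (v - w))
        \<longlonglongrightarrow> inner (F (w + 0 *\<^sub>R (v - w))) (v - w)"
      unfolding t_def
      by (intro tendsto_intros isCont_tendsto_compose[of _ F] LIMSEQ_inverse_real_of_nat)
         (use cont in \<open>auto simp: continuous_on_eq_continuous_at\<close>)
    ultimately have "0 \<le> inner (F (w + 0 *\<^sub>R (v - w))) (v - w)"
      by (intro LIMSEQ_le_const) auto
    then show ?thesis by simp
  qed
  then show ?thesis using \<open>w \<in> C\<close> by (simp add: VI_SOL_def)
qed

lemma VI_SOL_monotone_ge:
  assumes "monotone_operator F" "z \<in> VI_SOL C F" "v \<in> C"
  shows "0 \<le> inner (F v) (v - z)"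
proof -
  have "0 \<le> inner (F v - F z) (v - z)" "0 \<le> inner (F z) (v - z)"
    using assms by (auto simp: monotone_operator_def VI_SOL_def)
  then show ?thesis by (simp add: inner_diff_left)
qed


section \<open>One step of the projection-contraction method\<close>

lemma PC_d_norm_le:
  assumes sel: "b * norm (F u - F v) \<le> \<nu> * norm (u - v)" and "0 < b"
  shows "norm (PC_d F b e u v) \<le> (1 + \<nu>) * norm (u - v) + norm e"
proof -
  have "norm (PC_d F b e u v) \<le> norm (u - v) + norm (b *\<^sub>R (F u - F v)) + norm e"
    unfolding PC_d_def
    by (meson add_right_mono norm_triangle_ineq norm_triangle_ineq4 order_trans)
  moreover have "norm (b *\<^sub>R (F u - F v)) \<le> \<nu> * norm (u - v)"
    using sel \<open>0 < b\<close> by simp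
  ultimately show ?thesis unfolding distrib_right by linarith
qed

lemma PC_d_inner_ge:
  assumes sel: "b * norm (F u - F v) \<le> \<nu> * norm (u - v)" and "0 < b"
    and e: "norm e \<le> \<mu> * norm (u - v)"
  shows "(1 - \<nu> - \<mu>) * (norm (u - v))\<^sup>2 \<le> inner (u - v) (PC_d F b e u v)"
proof -
  define D where "D = norm (u - v)"
  have bF: "norm (b *\<^sub>R (F u - F v)) \<le> \<nu> * D"
    using sel \<open>0 < b\<close> by (simp add: D_def)
  have "inner (u - v) (b *\<^sub>R (F u - F v)) \<le> D * (\<nu> * D)"
    using norm_cauchy_schwarz[of "u - v" "b *\<^sub>R (F u - F v)"] bF
    by (metis D_def mult_left_mono norm_ge_zero order_trans)
  moreover have "inner (u - v) (- e) \<le> D * (\<mu> * D)"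
    using norm_cauchy_schwarz[of "u - v" "- e"] e
    by (metis D_def mult_left_mono norm_ge_zero norm_minus_cancel order_trans)
  moreover have "inner (u - v) (PC_d F b e u v)
      = D\<^sup>2 - inner (u - v) (b *\<^sub>R (F u - F v)) - inner (u - v) (- e)"
    by (simp only: PC_d_def D_def power2_norm_eq_inner inner_diff_right inner_add_right inner_minus_right)
  ultimately show ?thesis
    by (simp add: D_def[symmetric] algebra_simps power2_eq_square)
qed

text \<open>With \<open>d\<close> for the direction, the right-hand side is the square of \<open>inner (u - v) d / norm d\<close>. The
  selection rule and the bound on \<open>e\<close> keep \<open>d\<close> close enough to \<open>u - v\<close> that this quotient is at
  least a fixed positive multiple of \<open>norm (u - v)\<close>.\<close>

lemma PC_progress:
  assumes sel: "b * norm (F u - F v) \<le> \<nu> * norm (u - v)" and "0 < b"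
    and e: "norm e \<le> \<mu> * norm (u - v)" and "0 \<le> \<nu>" "0 \<le> \<mu>" "\<nu> + \<mu> < 1"
    and d: "PC_d F b e u v \<noteq> 0"
  shows "((1 - \<nu> - \<mu>) / (1 + \<nu> + \<mu>) * norm (u - v))\<^sup>2
    \<le> PC_rho F b e u v * inner (u - v) (PC_d F b e u v)"
proof -
  define D where "D = norm (u - v)"
  define m where "m = norm (PC_d F b e u v)"
  define c where "c = 1 - \<nu> - \<mu>"
  define s where "s = 1 + \<nu> + \<mu>"
  define I where "I = inner (u - v) (PC_d F b e u v)"
  have "0 < m" using d by (simp add: m_def)
  have "0 < s" "0 < c" using assms by (auto simp: s_def c_def)
  have I: "c * D\<^sup>2 \<le> I"
    using PC_d_inner_ge[OF assms(1-3)] by (simp add: D_def c_def I_def)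
  have m: "m \<le> s * D"
    using PC_d_norm_le[OF assms(1,2), of e] e by (simp add: D_def m_def s_def algebra_simps)
  have "c / s * D * m \<le> c / s * D * (s * D)"
    using m \<open>0 < c\<close> \<open>0 < s\<close> by (intro mult_left_mono) (auto simp: D_def)
  also have "\<dots> = c * D\<^sup>2" using \<open>0 < s\<close> by (simp add: power2_eq_square)
  finally have "c / s * D \<le> I / m"
    using I \<open>0 < m\<close> by (simp add: pos_le_divide_eq)
  then have "(c / s * D)\<^sup>2 \<le> (I / m)\<^sup>2"
    using \<open>0 < c\<close> \<open>0 < s\<close> by (intro power_mono) (auto simp: D_def)
  then show ?thesis
    by (simp add: PC_rho_def D_def m_def c_def s_def I_def power2_eq_square)
qed

text \<open>Test the projection inequality of the new point \<open>u'\<close> with \<open>z\<close>. The term \<open>inner (F v) (v - z)\<close>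
  has the right sign by monotonicity, and the projection inequality of \<open>v\<close>, tested with \<open>u'\<close>,
  trades \<open>b *\<^sub>R F v\<close> for the direction \<open>d\<close>. Completing the square absorbs
  \<open>u - u'\<close>, and the choice of \<open>PC_rho\<close> turns the square of the step into a multiple of
  \<open>inner (u - v) d\<close>.\<close>

lemma PC_step_descent:
  fixes C :: "'a::{real_inner, complete_space} set"
  assumes C: "C \<noteq> {}" "closed C" "convex C"
    and mono: "monotone_operator F" and z: "z \<in> VI_SOL C F"
    and "0 < b" "0 < \<gamma>" and rho: "0 \<le> PC_rho F b e u v"
    and v: "v = metric_proj C (u - b *\<^sub>R F u + e)" and d: "PC_d F b e u v \<noteq> 0"
    and u': "u' = metric_proj C (u - (\<gamma> * PC_rho F b e u v * b) *\<^sub>R F v + e')"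
  shows "(norm (u' - z))\<^sup>2 \<le> (norm (u - z))\<^sup>2
    - \<gamma> * (2 - \<gamma>) * (PC_rho F b e u v * inner (u - v) (PC_d F b e u v)) + 2 * norm (u' - z) * norm e'"
proof -
  define d where "d = PC_d F b e u v"
  define \<rho> where "\<rho> = PC_rho F b e u v"
  define t where "t = \<gamma> * \<rho>"
  have "0 \<le> t" using rho \<open>0 < \<gamma>\<close> by (simp add: t_def \<rho>_def)
  have mem: "v \<in> C" "u' \<in> C" "z \<in> C"
    using metric_proj_mem[OF C] z by (auto simp: v u' VI_SOL_def)
  have "b * inner (F v) (v - u') \<le> inner d (v - u')"
  proof -
    have "inner (u - b *\<^sub>R F u + e - v) (u' - v) \<le> 0"
      using metric_proj_obtuse_angle[OF C \<open>u' \<in> C\<close>] unfolding v by blast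
    then show ?thesis
      by (simp add: d_def PC_d_def inner_diff inner_add algebra_simps)
  qed
  then have "t * (b * inner (F v) (v - u')) \<le> t * inner d (v - u')"
    using \<open>0 \<le> t\<close> by (rule mult_left_mono)
  moreover have "0 \<le> t * (b * inner (F v) (v - z))"
    using VI_SOL_monotone_ge[OF mono z \<open>v \<in> C\<close>] \<open>0 \<le> t\<close> \<open>0 < b\<close> by simp
  moreover have "inner (u - (t * b) *\<^sub>R F v + e' - u') (z - u') \<le> 0"
    using metric_proj_obtuse_angle[OF C \<open>z \<in> C\<close>] unfolding u' t_def \<rho>_def by blast
  ultimately have key: "inner (u - u') (z - u') \<le> t * inner d (v - u') + inner e' (u' - z)"
    by (simp add: inner_diff inner_add algebra_simps)
  have "(norm (u' - z))\<^sup>2 = (norm (u - z))\<^sup>2 - (norm (u - u'))\<^sup>2 + 2 * inner (u - u') (z - u')"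
    by (simp add: power2_norm_eq_inner inner_diff inner_commute)
  also have "\<dots> \<le> (norm (u - z))\<^sup>2 - (norm (u - u'))\<^sup>2
      + 2 * (t * inner d (v - u')) + 2 * inner e' (u' - z)"
    using key by simp
  also have "\<dots> = (norm (u - z))\<^sup>2 - (norm (u - u' - t *\<^sub>R d))\<^sup>2 + t\<^sup>2 * (norm d)\<^sup>2
      - 2 * t * inner (u - v) d + 2 * inner e' (u' - z)"
    by (simp only: power2_norm_eq_inner)
       (simp add: inner_diff inner_commute algebra_simps power2_eq_square)
  also have "t\<^sup>2 * (norm d)\<^sup>2 = t * \<gamma> * inner (u - v) d"
    using d by (simp add: t_def \<rho>_def d_def PC_rho_def power2_eq_square)
  also have "2 * inner e' (u' - z) \<le> 2 * norm (u' - z) * norm e'"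
    using norm_cauchy_schwarz[of e' "u' - z"] by (simp add: mult.commute)
  finally have "(norm (u' - z))\<^sup>2 \<le> (norm (u - z))\<^sup>2 - (norm (u - u' - t *\<^sub>R d))\<^sup>2
      + t * \<gamma> * inner (u - v) d - 2 * t * inner (u - v) d + 2 * norm (u' - z) * norm e'"
    by simp
  also have "\<dots> \<le> (norm (u - z))\<^sup>2
      + t * \<gamma> * inner (u - v) d - 2 * t * inner (u - v) d + 2 * norm (u' - z) * norm e'"
    by simp
  finally show ?thesis by (simp add: d_def \<rho>_def t_def algebra_simps)
qed

text \<open>The projection inequality of \<open>v\<close>, tested with \<open>u\<close>, bounds \<open>inner (F v) (u - v)\<close> below in terms of the
  direction divided by \<open>b\<close>. Monotonicity replaces \<open>F v\<close> by the fixed vector \<open>F u\<close>, so that the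
  expression bounded below is affine in the iterate \<open>p\<close> and the bound survives weak limits.\<close>

lemma PC_residual_ge:
  fixes C :: "'a::{real_inner, complete_space} set"
  assumes C: "C \<noteq> {}" "closed C" "convex C"
    and mono: "monotone_operator F"
    and sel: "b * norm (F p - F v) \<le> \<nu> * norm (p - v)"
    and b: "0 < bmin" "bmin \<le> b" and "0 \<le> \<nu>"
    and v: "v = metric_proj C (p - b *\<^sub>R F p + e)" and "u \<in> C"
  shows "- (norm (u - v) * ((1 + \<nu>) * norm (p - v) + norm e) / bmin + norm (F u) * norm (p - v))
    \<le> inner (F u) (u - p)"
proof -
  define g where "g = PC_d F b e p v"
  define R where "R = (1 + \<nu>) * norm (p - v) + norm e"
  have "0 < b" using b by simp
  have "0 \<le> R" using \<open>0 \<le> \<nu>\<close> by (simp add: R_def)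
  have "inner (p - b *\<^sub>R F p + e - v) (u - v) \<le> 0"
    using metric_proj_obtuse_angle[OF C \<open>u \<in> C\<close>] unfolding v by blast
  then have "inner g (u - v) \<le> b * inner (F v) (u - v)"
    by (simp add: g_def PC_d_def inner_diff inner_add algebra_simps)
  also have "\<dots> \<le> b * inner (F u) (u - v)"
    using mono \<open>0 < b\<close> by (intro mult_left_mono) (auto simp: monotone_operator_def inner_diff_left)
  finally have "- (b * inner (F u) (u - v)) \<le> norm (u - v) * norm g"
    using Cauchy_Schwarz_ineq2[of g "u - v"] by (simp add: mult.commute)
  also have "\<dots> \<le> norm (u - v) * R"
    using PC_d_norm_le[OF sel \<open>0 < b\<close>, of e] by (intro mult_left_mono) (auto simp: g_def R_def)
  finally have "- inner (F u) (u - v) \<le> norm (u - v) * R / b"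
    using \<open>0 < b\<close> by (simp add: field_simps)
  also have "\<dots> \<le> norm (u - v) * R / bmin"
    using b \<open>0 \<le> R\<close> by (intro divide_left_mono) auto
  finally have "- (norm (u - v) * R / bmin) \<le> inner (F u) (u - v)" by simp
  moreover have "inner (F u) (p - v) \<le> norm (F u) * norm (p - v)"
    by (rule norm_cauchy_schwarz)
  ultimately show ?thesis by (simp add: R_def inner_diff_right)
qed


section \<open>Convergence\<close>

lemma quasi_decreasing_convergent:
  fixes a \<epsilon> :: "nat \<Rightarrow> real"
  assumes "\<And>k. 0 \<le> a k" "\<And>k. 0 \<le> \<epsilon> k" "summable \<epsilon>" "\<And>k. a (Suc k) \<le> a k + \<epsilon> k"
  shows "convergent a"
proof -
  define b where "b k = a k - (\<Sum>i<k. \<epsilon> i)" for k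
  have "decseq b"
    unfolding decseq_Suc_iff b_def using assms(4) by (simp add: algebra_simps)
  moreover have "\<forall>k. - suminf \<epsilon> \<le> b k"
  proof
    fix k
    have "(\<Sum>i<k. \<epsilon> i) \<le> suminf \<epsilon>" using assms by (intro sum_le_suminf) auto
    then show "- suminf \<epsilon> \<le> b k" using assms(1)[of k] by (simp add: b_def)
  qed
  ultimately obtain l where "b \<longlonglongrightarrow> l" using decseq_convergent by blast
  then have "(\<lambda>k. b k + (\<Sum>i<k. \<epsilon> i)) \<longlonglongrightarrow> l + suminf \<epsilon>"
    using assms by (intro tendsto_add summable_LIMSEQ)
  then show ?thesis by (auto simp: b_def convergent_def)
qed

lemma square_step_linear:
  fixes a a' \<epsilon> :: real
  assumes "0 \<le> a" "0 \<le> \<epsilon>" "a'\<^sup>2 \<le> a\<^sup>2 + 2 * a' * \<epsilon>"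
  shows "a' \<le> a + 2 * \<epsilon>"
proof -
  have "(a' - \<epsilon>)\<^sup>2 \<le> (a + \<epsilon>)\<^sup>2"
    unfolding power2_diff power2_sum using assms(3) mult_nonneg_nonneg[OF assms(1,2)] by linarith
  then show ?thesis using power2_le_imp_le[of "a' - \<epsilon>" "a + \<epsilon>"] assms by simp
qed

theorem theorem3p9:
  fixes C :: "'a::{real_inner, complete_space} set"
    and F :: "'a \<Rightarrow> 'a"
    and \<nu> \<gamma> \<mu> L \<beta>min :: real
    and \<beta> :: "nat \<Rightarrow> real"
    and e1 e2 x y :: "nat \<Rightarrow> 'a"
  assumes "C \<noteq> {}" and "closed C" and "convex C"
    and "VI_SOL C F \<noteq> {}"
    and "monotone_operator F"
    and "0 < L" and "L-lipschitz_on UNIV F"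
    and "0 < \<nu>" and "\<nu> < 1"
    and "0 < \<gamma>" and "\<gamma> < 2"
    and "PC_II_run C F \<nu> \<gamma> e1 e2 \<beta> x y"
    and "0 < \<beta>min" and "\<And>k. \<beta>min \<le> \<beta> k"
    and "summable (\<lambda>k. norm (e1 k))"
    and "summable (\<lambda>k. norm (e2 k))"
    and "0 \<le> \<mu>" and "\<mu> < 1 - \<nu>"
    and "\<And>k. norm (e1 k) \<le> \<mu> * norm (x k - y k)"
  shows "\<exists>z \<in> VI_SOL C F. weakly_converges x z"
proof -
  note C = assms(1-3)
  note mono = assms(5)
  have y: "y k = metric_proj C (x k - \<beta> k *\<^sub>R F (x k) + e1 k)"
    and beta: "0 < \<beta> k"
    and sel: "\<beta> k * norm (F (x k) - F (y k)) \<le> \<nu> * norm (x k - y k)"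
    and d: "PC_d F (\<beta> k) (e1 k) (x k) (y k) \<noteq> 0"
    and x: "x (Suc k) = metric_proj C
        (x k - (\<gamma> * PC_rho F (\<beta> k) (e1 k) (x k) (y k) * \<beta> k) *\<^sub>R F (y k) + e2 k)" for k
    using assms(12) unfolding PC_II_run_def by blast+
  have xC: "x (Suc k) \<in> C" for k
    unfolding x by (rule metric_proj_mem[OF C])
  define c where "c = (1 - \<nu> - \<mu>) / (1 + \<nu> + \<mu>)"
  have "0 < c" using assms by (simp add: c_def)
  have c: "(c * norm (x k - y k))\<^sup>2 \<le> PC_rho F (\<beta> k) (e1 k) (x k) (y k)
      * inner (x k - y k) (PC_d F (\<beta> k) (e1 k) (x k) (y k))" for k
    unfolding c_def using assms by (intro PC_progress sel beta d) auto
  have rho: "0 \<le> PC_rho F (\<beta> k) (e1 k) (x k) (y k)" for k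
  proof -
    have "0 \<le> (1 - \<nu> - \<mu>) * (norm (x k - y k))\<^sup>2" using assms by simp
    also have "\<dots> \<le> inner (x k - y k) (PC_d F (\<beta> k) (e1 k) (x k) (y k))"
      by (rule PC_d_inner_ge[OF sel beta assms(19)])
    finally show ?thesis by (simp add: PC_rho_def)
  qed
  have descent: "(norm (x (Suc k) - z))\<^sup>2 \<le> (norm (x k - z))\<^sup>2
      - \<gamma> * (2 - \<gamma>) * (c * norm (x k - y k))\<^sup>2 + 2 * norm (x (Suc k) - z) * norm (e2 k)"
    if "z \<in> VI_SOL C F" for z k
  proof -
    have "\<gamma> * (2 - \<gamma>) * (c * norm (x k - y k))\<^sup>2 \<le> \<gamma> * (2 - \<gamma>) *
        (PC_rho F (\<beta> k) (e1 k) (x k) (y k) * inner (x k - y k) (PC_d F (\<beta> k) (e1 k) (x k) (y k)))"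
      using assms(10,11) by (intro mult_left_mono[OF c]) simp
    then show ?thesis
      using PC_step_descent[OF C mono that beta[of k] assms(10) rho y d x] by linarith
  qed
  have conv: "convergent (\<lambda>k. norm (x k - z))" if z: "z \<in> VI_SOL C F" for z
  proof (rule quasi_decreasing_convergent[where \<epsilon> = "\<lambda>k. 2 * norm (e2 k)"])
    show "summable (\<lambda>k. 2 * norm (e2 k))" using assms(16) by (rule summable_mult)
    show "norm (x (Suc k) - z) \<le> norm (x k - z) + 2 * norm (e2 k)" for k
    proof (rule square_step_linear)
      have "0 \<le> \<gamma> * (2 - \<gamma>) * (c * norm (x k - y k))\<^sup>2" using assms(10,11) by simp
      then show "(norm (x (Suc k) - z))\<^sup>2
          \<le> (norm (x k - z))\<^sup>2 + 2 * norm (x (Suc k) - z) * norm (e2 k)"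
        using descent[OF z, of k] by linarith
    qed auto
  qed auto
  have e1_0: "(\<lambda>k. norm (e1 k)) \<longlonglongrightarrow> 0" and e2_0: "(\<lambda>k. norm (e2 k)) \<longlonglongrightarrow> 0"
    using assms(15,16) by (auto intro: summable_LIMSEQ_zero)
  have xy_0: "(\<lambda>k. norm (x k - y k)) \<longlonglongrightarrow> 0"
  proof -
    obtain z where z: "z \<in> VI_SOL C F" using assms(4) by blast
    define a where "a k = norm (x k - z)" for k
    obtain l where l: "a \<longlonglongrightarrow> l"
      using conv[OF z] by (auto simp: a_def[abs_def] convergent_def)
    have "(\<lambda>k. (a k)\<^sup>2 - (a (Suc k))\<^sup>2 + 2 * a (Suc k) * norm (e2 k)) \<longlonglongrightarrow> l\<^sup>2 - l\<^sup>2 + 2 * l * 0"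
      by (intro tendsto_intros l LIMSEQ_Suc[OF l] e2_0)
    then have "(\<lambda>k. (a k)\<^sup>2 - (a (Suc k))\<^sup>2 + 2 * a (Suc k) * norm (e2 k)) \<longlonglongrightarrow> 0" by simp
    \<comment> \<open>The descent inequality, solved for the decrease, places it below this null sequence.\<close>
    then have "(\<lambda>k. \<gamma> * (2 - \<gamma>) * (c * norm (x k - y k))\<^sup>2) \<longlonglongrightarrow> 0"
    proof (rule tendsto_sandwich[rotated 3])
      show "eventually (\<lambda>k. 0 \<le> \<gamma> * (2 - \<gamma>) * (c * norm (x k - y k))\<^sup>2) sequentially"
        using assms(10,11) by simp
      show "eventually (\<lambda>k. \<gamma> * (2 - \<gamma>) * (c * norm (x k - y k))\<^sup>2
          \<le> (a k)\<^sup>2 - (a (Suc k))\<^sup>2 + 2 * a (Suc k) * norm (e2 k)) sequentially"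
        using descent[OF z] by (simp add: a_def algebra_simps)
    qed auto
    then have "(\<lambda>k. sqrt (\<gamma> * (2 - \<gamma>) * (c * norm (x k - y k))\<^sup>2 / (\<gamma> * (2 - \<gamma>) * c\<^sup>2)))
        \<longlonglongrightarrow> sqrt (0 / (\<gamma> * (2 - \<gamma>) * c\<^sup>2))"
      using assms(10,11) \<open>0 < c\<close> by (intro tendsto_intros) auto
    then show ?thesis
      using assms(10,11) \<open>0 < c\<close> by (simp add: power_mult_distrib)
  qed
  have "w \<in> VI_SOL C F" if w: "\<And>n. w \<in> tail_hull x n" for w
  proof (rule minty)
    show "continuous_on UNIV F" using assms(7) by (rule lipschitz_on_continuous_on)
    \<comment> \<open>The starting point is arbitrary, so only the tail from 1 on lies in \<open>C\<close>.\<close>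
    have "tail_hull x 1 \<subseteq> C"
      using xC C by (intro tail_hull_subset) (auto simp: Suc_le_eq gr0_conv_Suc)
    then show "w \<in> C" using w by blast
    fix u assume u: "u \<in> C"
    obtain z where z: "z \<in> VI_SOL C F" using assms(4) by blast
    then obtain l where l: "(\<lambda>k. norm (x k - z)) \<longlonglongrightarrow> l"
      using conv by (auto simp: convergent_def)
    \<comment> \<open>\<open>B k\<close> bounds \<open>norm (u - y k)\<close> by quantities already known to converge.\<close>
    define B where "B k = norm (u - z) + norm (x k - z) + norm (x k - y k)" for k
    define R where "R k = (1 + \<nu>) * norm (x k - y k) + norm (e1 k)" for k
    define \<delta> where "\<delta> k = B k * R k / \<beta>min + norm (F u) * norm (x k - y k)" for k
    have "\<delta> \<longlonglongrightarrow> (norm (u - z) + l + 0) * ((1 + \<nu>) * 0 + 0) / \<beta>min + norm (F u) * 0"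
      unfolding \<delta>_def B_def R_def using assms(13) by (intro tendsto_intros l xy_0 e1_0) simp
    then have \<delta>: "\<delta> \<longlonglongrightarrow> 0" by simp
    have residual: "- \<delta> k \<le> inner (F u) (u - x k)" for k
    proof -
      have "norm (u - y k) \<le> B k"
        using norm_triangle_ineq[of "u - z" "z - y k"] norm_triangle_ineq[of "z - x k" "x k - y k"]
        by (simp add: B_def norm_minus_commute)
      then have "norm (u - y k) * R k / \<beta>min \<le> B k * R k / \<beta>min"
        using assms(8,13) by (intro divide_right_mono mult_right_mono) (auto simp: R_def)
      moreover have "- (norm (u - y k) * R k / \<beta>min + norm (F u) * norm (x k - y k))
          \<le> inner (F u) (u - x k)"
        unfolding R_def using assms(8) by (intro PC_residual_ge[OF C mono sel assms(13,14) _ y u]) simp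
      ultimately show ?thesis unfolding \<delta>_def by linarith
    qed
    have "- inner (F u) u \<le> - inner (F u) w"
    proof (rule dense_le)
      fix b assume "b < - inner (F u) u"
      then have "eventually (\<lambda>k. \<delta> k < - inner (F u) u - b) sequentially"
        by (intro order_tendstoD(2)[OF \<delta>]) simp
      then have "eventually (\<lambda>k. b \<le> - inner (F u) (x k)) sequentially"
      proof eventually_elim
        case (elim k)
        then show ?case using residual[of k] by (simp add: inner_diff_right)
      qed
      then show "b \<le> - inner (F u) w"
        using tail_hull_linear_ge[OF bounded_linear_minus[OF bounded_linear_inner_right] _ w] by blast
    qed
    then show "0 \<le> inner (F u) (u - w)" by (simp add: inner_diff_right)
  qed fact
  then show ?thesis using opial_tail_hull[OF assms(4) conv] by blast
qed

end
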